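(* The set $A_\Delta$ is non-empty: it contains a point $z_0\approx1.344\,i$ for which $c_{z_0}(\Delta,2)=0$.
   Context: $\Delta(z)=q\prod_{n\ge1}(1-q^n)^{24}$, $q=e^{2\pi iz}$. For $z_0=\alpha+i\beta\in\mathbb H$, $\sigma_{z_0}=\frac{1}{2i\beta}\begin{pmatrix}-\overline{z_0}&z_0\\-1&1\end{pmatrix}$, $(f|_{12}\gamma)(z)=\det(\gamma)^6f(\gamma z)(cz+d)^{-12}$, and $c_{z_0}(\Delta,n)$ is defined by $(\Delta|_{12}\sigma_{z_0})(z)=\sum_{n\ge0}c_{z_0}(\Delta,n)z^n$. $A_\Delta$ is the set of $z_0\in\mathbb H\cup\mathbb Q\cup\{\infty\}$ such that $c_{z_0}(\Delta,n)=0$ for some non-trivial $n$ (for $z_0\in\mathbb H$ with stabilizer of order $N$ in $\mathrm{PSL}(2,\mathbb Z)$, $n$ is non-trivial iff $n\equiv-6\bmod N$; at cusps all $n\ge1$ are non-trivial, with coefficients taken from the expansion at that cusp). For $z_0$ on the imaginary axis other than $i$ the stabilizer is trivial, so $n=2$ is non-trivial. *)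

theory Defs
  imports "HOL-Complex_Analysis.Complex_Analysis" "HOL-Number_Theory.Cong"
begin

definition modular_Delta :: "complex \<Rightarrow> complex" where
  "modular_Delta z = (let q = exp (2 * of_real pi * \<i> * z)
                      in q * (\<Prod>n. (1 - q ^ Suc n) ^ 24))"

definition frac_lin :: "complex^2^2 \<Rightarrow> complex \<Rightarrow> complex" where
  "frac_lin A z = (A$1$1 * z + A$1$2) / (A$2$1 * z + A$2$2)"

definition slash12 :: "(complex \<Rightarrow> complex) \<Rightarrow> complex^2^2 \<Rightarrow> complex \<Rightarrow> complex" where
  "slash12 f A z = det A ^ 6 * f (frac_lin A z) / (A$2$1 * z + A$2$2) ^ 12"

definition sigma_mat :: "complex \<Rightarrow> complex^2^2" where
  "sigma_mat z\<^sub>0 = map_matrix (\<lambda>x. x / (2 * \<i> * of_real (Im z\<^sub>0)))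
     (vector [vector [- cnj z\<^sub>0, z\<^sub>0], vector [-1, 1]])"

text \<open>For \<open>Im z\<^sub>0 > 0\<close> the matrix \<open>sigma_mat z\<^sub>0\<close> maps the open unit disc onto the
  upper half-plane and \<open>0\<close> to \<open>z\<^sub>0\<close>, so the function expanded here is holomorphic on the
  unit disc.\<close>

definition interior_coeff :: "(complex \<Rightarrow> complex) \<Rightarrow> complex \<Rightarrow> nat \<Rightarrow> complex" where
  "interior_coeff f z\<^sub>0 n = fps_nth (fps_expansion (slash12 f (sigma_mat z\<^sub>0)) 0) n"

definition SL2Z :: "(int^2^2) set" where
  "SL2Z = {A. det A = 1}"

abbreviation complex_matrix :: "int^2^2 \<Rightarrow> complex^2^2" where
  "complex_matrix \<equiv> map_matrix of_int"

text \<open>Elements of \<open>PSL(2,\<int>)\<close> are represented as classes \<open>{A, -A}\<close> with \<open>A \<in> SL2Z\<close>.\<close>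

definition PSL_stabilizer :: "complex \<Rightarrow> (int^2^2) set set" where
  "PSL_stabilizer z\<^sub>0 = {{A, - A} | A. A \<in> SL2Z \<and> frac_lin (complex_matrix A) z\<^sub>0 = z\<^sub>0}"

definition nontrivial_index :: "complex \<Rightarrow> nat \<Rightarrow> bool" where
  "nontrivial_index z\<^sub>0 n \<longleftrightarrow> [int n = - 6] (mod int (card (PSL_stabilizer z\<^sub>0)))"

text \<open>A point of \<open>\<complex> \<union> {\<infinity>}\<close> is \<open>Some z\<close> or, for \<open>\<infinity>\<close>, \<open>None\<close>.\<close>

definition cusps :: "complex option set" where
  "cusps = insert None (Some ` \<rat>)"

definition image_of_infinity :: "int^2^2 \<Rightarrow> complex option" where
  "image_of_infinity A =
     (if A$2$1 = 0 then None else Some (of_int (A$1$1) / of_int (A$2$1)))"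

text \<open>\<open>a\<close> is the sequence of \<open>q\<close>-expansion coefficients of \<open>f\<close> at the cusp \<open>x\<close>. For a level
  one form of weight 12 these do not depend on the choice of \<open>A\<close>, and all cusps have width
  one.\<close>

definition cusp_expansion ::
    "(complex \<Rightarrow> complex) \<Rightarrow> complex option \<Rightarrow> (nat \<Rightarrow> complex) \<Rightarrow> bool" where
  "cusp_expansion f x a \<longleftrightarrow>
     (\<exists>A\<in>SL2Z. image_of_infinity A = x \<and>
        (\<forall>z. Im z > 0 \<longrightarrow>
           (\<lambda>n. a n * exp (2 * of_real pi * \<i> * z) ^ n) sums
             slash12 f (complex_matrix A) z))"

definition A_Delta :: "complex option set" where
  "A_Delta =
     {Some z\<^sub>0 | z\<^sub>0. Im z\<^sub>0 > 0 \<and>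
        (\<exists>n. nontrivial_index z\<^sub>0 n \<and> interior_coeff modular_Delta z\<^sub>0 n = 0)} \<union>
     {x \<in> cusps. \<exists>a. cusp_expansion modular_Delta x a \<and> (\<exists>n\<ge>1. a n = 0)}"

end

theory Submission
  imports Defs
begin

text \<open>
  Write \<open>\<Delta>(z) = K(q)\<close> with \<open>K(q) = q \<Prod>(1 - q\<^sup>n)\<^sup>2\<^sup>4\<close>. On the imaginary axis, with \<open>x = 2\<pi>\<beta>\<close> and
  \<open>q = exp (-x)\<close>, the second Taylor coefficient at \<open>\<i>\<beta>\<close> is a nonzero multiple of the real number
  \<open>39 K - 13 x q K' + x\<^sup>2 (q K' + q\<^sup>2 K'')\<close>. Its sign changes between \<open>x = 8.442\<close> and \<open>x = 8.447\<close>: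
  there \<open>q\<close> is about \<open>2.15 \<cdot> 10\<^sup>-\<^sup>4\<close>, and \<open>K = q - 24 q\<^sup>2 + 252 q\<^sup>3 + O(q\<^sup>4)\<close>, with Cauchy estimates on the
  disc of radius \<open>q\<close> about \<open>q\<close> for the derivatives of the error term, is precise enough. The
  stabilizer of \<open>\<i>\<beta>\<close> is trivial for \<open>\<beta> > 1\<close>.
\<close>

section \<open>The product expansion in the variable \<open>q\<close>\<close>

text \<open>Euler's function. Keeping the exponent 24 outside the product reduces convergence,
  holomorphy and estimates to factors of the form \<open>1 - q ^ Suc n\<close>.\<close>

definition euler_prod :: "complex \<Rightarrow> complex" where
  "euler_prod q = (\<Prod>n. 1 - q ^ Suc n)"

definition Delta_q :: "complex \<Rightarrow> complex" where
  "Delta_q q = q * euler_prod q ^ 24"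

lemma summable_norm_power_Suc:
  fixes q :: complex
  assumes "norm q < 1"
  shows "summable (\<lambda>n. norm (q ^ Suc n))"
  using assms by (simp add: norm_mult norm_power summable_mult summable_geometric)

lemma convergent_euler_prod:
  fixes q :: complex
  assumes "norm q < 1"
  shows "convergent_prod (\<lambda>n. 1 - q ^ Suc n)"
proof -
  have "summable (\<lambda>n. norm ((1 - q ^ Suc n) - 1))"
    using summable_norm_power_Suc[OF assms] by simp
  then show ?thesis
    by (intro abs_convergent_prod_imp_convergent_prod) (simp only: abs_convergent_prod_conv_summable)
qed

lemma euler_prod_LIMSEQ:
  assumes "norm q < 1"
  shows "(\<lambda>N. \<Prod>n<N. 1 - q ^ Suc n) \<longlonglongrightarrow> euler_prod q"
proof -
  have "(\<lambda>N. \<Prod>n\<le>N. 1 - q ^ Suc n) \<longlonglongrightarrow> euler_prod q"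
    unfolding euler_prod_def by (rule convergent_prod_LIMSEQ[OF convergent_euler_prod[OF assms]])
  then have "(\<lambda>N. \<Prod>n<Suc N. 1 - q ^ Suc n) \<longlonglongrightarrow> euler_prod q"
    by (simp only: lessThan_Suc_atMost)
  then show ?thesis
    by (rule LIMSEQ_imp_Suc)
qed

lemma modular_Delta_eq_Delta_q:
  assumes "Im z > 0"
  shows "modular_Delta z = Delta_q (exp (2 * of_real pi * \<i> * z))"
proof -
  have "norm (exp (2 * of_real pi * \<i> * z)) < 1"
    using assms by (simp add: norm_exp_eq_Re)
  from prodinf_power[OF convergent_euler_prod[OF this], of 24] show ?thesis
    by (simp add: modular_Delta_def Delta_q_def euler_prod_def Let_def)
qed

lemma holomorphic_euler_prod: "euler_prod holomorphic_on ball 0 1"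
proof (rule holomorphic_uniform_sequence[where f = "\<lambda>N q. \<Prod>n<N. 1 - q ^ Suc n"])
  show "open (ball (0::complex) 1)" by simp
  show "(\<lambda>q. \<Prod>n<N. 1 - q ^ Suc n) holomorphic_on ball 0 1" for N
    by (intro holomorphic_intros)
  fix x :: complex
  assume x: "x \<in> ball 0 1"
  define d where "d = (1 - norm x) / 2"
  define r where "r = norm x + d"
  have r: "0 < r" "r < 1" and "d > 0"
    using x by (simp_all add: r_def d_def field_simps add_pos_nonneg)
  have nle: "norm y \<le> r" if "y \<in> cball x d" for y
    using that norm_triangle_ineq[of x "y - x"] by (simp add: r_def dist_norm norm_minus_commute)
  have d: "d > 0" "cball x d \<subseteq> ball 0 1"
    using \<open>d > 0\<close> nle le_less_trans[OF _ r(2)] by (auto simp del: mem_cball)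
  have "uniformly_convergent_on (cball x d) (\<lambda>N q. \<Prod>n<N. 1 - q ^ Suc n)"
  proof (rule uniformly_convergent_on_prod')
    show "continuous_on (cball x d) (\<lambda>q. 1 - q ^ Suc n)" for n
      by (intro continuous_intros)
    have "uniformly_convergent_on (cball x d) (\<lambda>N q. \<Sum>n<N. norm (q ^ Suc n))"
    proof (rule Weierstrass_m_test')
      show "norm (norm (y ^ Suc n)) \<le> r ^ Suc n" if "y \<in> cball x d" for n y
        using power_mono[OF nle[OF that], of "Suc n"] by (simp add: norm_power norm_mult)
      show "summable (\<lambda>n. r ^ Suc n)"
        using r by (simp add: summable_mult summable_geometric)
    qed
    then show "uniformly_convergent_on (cball x d) (\<lambda>N q. \<Sum>n<N. norm (1 - q ^ Suc n - 1))"
      by simp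
  qed auto
  then obtain g where g: "uniform_limit (cball x d) (\<lambda>N q. \<Prod>n<N. 1 - q ^ Suc n) g sequentially"
    by (auto simp: uniformly_convergent_on_def)
  have "g y = euler_prod y" if "y \<in> cball x d" for y
    using LIMSEQ_unique[OF tendsto_uniform_limitI[OF g that] euler_prod_LIMSEQ]
      nle[OF that] r by simp
  then have "uniform_limit (cball x d) (\<lambda>N q. \<Prod>n<N. 1 - q ^ Suc n) euler_prod sequentially"
    using uniform_limit_cong'[OF refl, of "cball x d" g euler_prod] g by blast
  with d show "\<exists>d>0. cball x d \<subseteq> ball 0 1 \<and>
      uniform_limit (cball x d) (\<lambda>N q. \<Prod>n<N. 1 - q ^ Suc n) euler_prod sequentially"
    by blast
qed

lemma holomorphic_Delta_q: "Delta_q holomorphic_on ball 0 1"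
  unfolding Delta_q_def by (intro holomorphic_intros holomorphic_euler_prod)

section \<open>Real values on the real axis\<close>

lemma Delta_q_in_Reals:
  assumes "q \<in> \<real>" "norm q < 1"
  shows "Delta_q q \<in> \<real>"
proof -
  have "\<And>N. (\<Prod>n<N. 1 - q ^ Suc n) \<in> \<real>"
    using assms(1) by (intro prod_in_Reals Reals_diff Reals_power) auto
  then have "euler_prod q \<in> \<real>"
    by (intro Lim_in_closed_set[OF closed_complex_Reals always_eventually
          sequentially_bot euler_prod_LIMSEQ[OF assms(2)]]) blast
  then show ?thesis
    using assms(1) by (simp add: Delta_q_def Reals_mult Reals_power)
qed

text \<open>Along the real increments \<open>1 / (n + 1)\<close> the difference quotients at a real
  point are real, and \<real> is closed in \<complex>.\<close>

lemma deriv_in_Reals: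
  fixes f :: "complex \<Rightarrow> complex"
  assumes "f holomorphic_on S" "open S" "x \<in> S" "x \<in> \<real>"
    and real: "\<And>y. y \<in> S \<Longrightarrow> y \<in> \<real> \<Longrightarrow> f y \<in> \<real>"
  shows "deriv f x \<in> \<real>"
proof -
  define h where "h n = complex_of_real (inverse (real (Suc n)))" for n
  have h0: "h \<longlonglongrightarrow> 0"
    unfolding h_def using tendsto_of_real[OF LIMSEQ_inverse_real_of_nat]
    by (simp only: of_real_0)
  have hn: "h n \<noteq> 0" "h n \<in> \<real>" for n
    by (auto simp: h_def simp del: of_nat_Suc)
  have "(f has_field_derivative deriv f x) (at x)"
    using assms(1-3) by (rule holomorphic_derivI)
  then have "(\<lambda>h. (f (x + h) - f x) / h) \<midarrow>0\<rightarrow> deriv f x"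
    by (simp add: DERIV_def)
  then have "(\<lambda>n. (f (x + h n) - f x) / h n) \<longlonglongrightarrow> deriv f x"
    by (rule filterlim_compose) (use h0 hn in \<open>auto simp: filterlim_at\<close>)
  \<comment> \<open>Realness of \<open>f\<close> is only known on \<open>S\<close>; since
    \<open>S\<close> is open, the points \<open>x + h n\<close> eventually lie in it.\<close>
  moreover have "\<forall>\<^sub>F n in sequentially. x + h n \<in> S"
    using h0 by (intro topological_tendstoD[OF tendsto_add[OF tendsto_const h0]]) (use assms in auto)
  then have "\<forall>\<^sub>F n in sequentially. (f (x + h n) - f x) / h n \<in> \<real>"
    by eventually_elim
      (use assms(3,4) hn in \<open>auto intro!: Reals_divide Reals_diff real Reals_add\<close>)
  ultimately show ?thesis
    using Lim_in_closed_set[OF closed_complex_Reals] by (metis sequentially_bot)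
qed

lemma Delta_q_derivs_in_Reals:
  assumes "q \<in> \<real>" "norm q < 1"
  shows "deriv Delta_q q \<in> \<real>" "deriv (deriv Delta_q) q \<in> \<real>"
proof -
  have *: "deriv Delta_q y \<in> \<real>" if "y \<in> ball 0 1" "y \<in> \<real>" for y
    by (rule deriv_in_Reals[OF holomorphic_Delta_q])
      (use that in \<open>auto intro: Delta_q_in_Reals\<close>)
  then show "deriv Delta_q q \<in> \<real>" using assms by simp
  have "deriv Delta_q holomorphic_on ball 0 1"
    by (intro holomorphic_deriv holomorphic_Delta_q) auto
  then show "deriv (deriv Delta_q) q \<in> \<real>"
    by (rule deriv_in_Reals) (use assms * in auto)
qed

section \<open>Explicit cubic error bounds near \<open>q = 0\<close>\<close>

text \<open>A product of factors \<open>1 + a n\<close> differs from 1 by at most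
  \<open>exp S - 1\<close>, with \<open>S\<close> the sum of the \<open>norm (a n)\<close>. Here
  \<open>S\<close> is dominated by a geometric series starting at \<open>r ^ 3\<close>, and
  \<open>exp u - 1 \<le> u + u\<^sup>2\<close> leaves ample room below
  \<open>2 * r ^ 3\<close>.\<close>

lemma norm_euler_tail_minus_1:
  fixes q :: complex
  assumes "norm q \<le> 1/1000"
  shows "norm ((\<Prod>n<N. 1 - q ^ (n + 3)) - 1) \<le> 2 * norm q ^ 3"
proof -
  define r where "r = norm q"
  have r: "0 \<le> r" "r \<le> 1/1000" using assms by (auto simp: r_def)
  have r3: "r ^ 3 \<le> (1/1000) ^ 3" using r by (intro power_mono) auto
  have "(\<Sum>n<N. r ^ n) \<le> (\<Sum>n. r ^ n)"
    using r by (intro sum_le_suminf summable_geometric) auto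
  also have "\<dots> = 1 / (1 - r)" using r by (intro suminf_geometric) auto
  also have "\<dots> \<le> 1.5" using r by (simp add: field_simps)
  finally have s: "(\<Sum>n<N. r ^ n) \<le> 1.5" .
  define u where "u = 1.5 * r ^ 3"
  have u: "0 \<le> u" "u \<le> 1/1000" using r r3 by (auto simp: u_def power_divide)
  have "norm ((\<Prod>n<N. 1 + - (q ^ (n + 3))) - 1) \<le> (\<Prod>n<N. 1 + norm (- (q ^ (n + 3)))) - 1"
    by (rule norm_prod_minus1_le_prod_minus1)
  also have "(\<Prod>n<N. 1 + norm (- (q ^ (n + 3)))) \<le> exp (\<Sum>n<N. norm (- (q ^ (n + 3))))"
    by (rule prod_le_exp_sum) auto
  also have "(\<Sum>n<N. norm (- (q ^ (n + 3)))) = r ^ 3 * (\<Sum>n<N. r ^ n)"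
    by (simp add: norm_power norm_mult power_add sum_distrib_left sum_distrib_right r_def mult.commute)
  also have "exp (r ^ 3 * (\<Sum>n<N. r ^ n)) \<le> exp u"
    using mult_right_mono[OF s, of "r ^ 3"] r by (simp add: u_def mult.commute)
  also have "exp u \<le> 1 + u + u\<^sup>2" using u by (intro exp_bound) auto
  also have "1 + u + u\<^sup>2 - 1 \<le> 2 * r ^ 3"
  proof -
    have "u\<^sup>2 \<le> u * (1/1000)" using u unfolding power2_eq_square by (intro mult_left_mono) auto
    moreover have "0 \<le> r ^ 3" using r by simp
    ultimately show ?thesis unfolding u_def by linarith
  qed
  finally show ?thesis by (simp add: r_def)
qed

text \<open>The first two factors multiply to \<open>1 - q - q\<^sup>2 + q ^ 3\<close>, of norm at
  most 1.5, and the other factors differ from 1 by at most \<open>2 * norm q ^ 3\<close> in total.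
  This gives the constant 4 = 1.5 * 2 + 1 for all partial products, hence for the limit.\<close>

lemma euler_prod_approx:
  fixes q :: complex
  assumes "norm q \<le> 1/1000"
  shows "norm (euler_prod q - (1 - q - q\<^sup>2)) \<le> 4 * norm q ^ 3"
proof -
  define r where "r = norm q"
  have r: "0 \<le> r" "r \<le> 1/1000" using assms by (auto simp: r_def)
  have rp: "r ^ 2 \<le> (1/1000) ^ 2" "r ^ 3 \<le> (1/1000) ^ 3"
    using r by (intro power_mono; simp)+
  have bound: "norm ((\<Prod>n<N + 2. 1 - q ^ Suc n) - (1 - q - q\<^sup>2)) \<le> 4 * r ^ 3" for N
  proof -
    define T where "T = (\<Prod>n<N. 1 - q ^ (n + 3))"
    have "(\<Prod>n<Suc (Suc N). 1 - q ^ Suc n) = (1 - q) * (1 - q\<^sup>2) * T"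
      unfolding prod.lessThan_Suc_shift T_def
      by (simp add: power2_eq_square numeral_3_eq_3 mult_ac)
    then have eq: "(\<Prod>n<N + 2. 1 - q ^ Suc n) - (1 - q - q\<^sup>2)
        = (1 - q - q\<^sup>2 + q ^ 3) * (T - 1) + q ^ 3"
      by (simp add: algebra_simps power2_eq_square power3_eq_cube)
    have "norm (1 - q - q\<^sup>2 + q ^ 3) \<le> 1 + r + r\<^sup>2 + r ^ 3"
      unfolding r_def
      by (rule order_trans[OF norm_triangle_ineq] order_trans[OF norm_triangle_ineq4]
          add_mono order_refl | simp add: norm_power)+
    also have "\<dots> \<le> 1.5" using r rp by (simp add: power_divide)
    finally have 1: "norm (1 - q - q\<^sup>2 + q ^ 3) \<le> 1.5" .
    have 2: "norm (T - 1) \<le> 2 * r ^ 3"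
      using norm_euler_tail_minus_1[OF assms] by (simp add: T_def r_def)
    have "norm ((1 - q - q\<^sup>2 + q ^ 3) * (T - 1) + q ^ 3) \<le> 1.5 * (2 * r ^ 3) + r ^ 3"
      using mult_mono[OF 1 2] norm_triangle_ineq[of "(1 - q - q\<^sup>2 + q ^ 3) * (T - 1)" "q ^ 3"]
      by (simp add: norm_mult norm_power r_def)
    then show ?thesis unfolding eq by simp
  qed
  have "(\<lambda>N. \<Prod>n<N + 2. 1 - q ^ Suc n) \<longlonglongrightarrow> euler_prod q"
    using euler_prod_LIMSEQ[of q] assms by (intro LIMSEQ_ignore_initial_segment) auto
  then have "(\<lambda>N. norm ((\<Prod>n<N + 2. 1 - q ^ Suc n) - (1 - q - q\<^sup>2)))
      \<longlonglongrightarrow> norm (euler_prod q - (1 - q - q\<^sup>2))"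
    by (intro tendsto_intros)
  then show ?thesis
    by (rule Lim_bounded) (use bound in \<open>auto simp: r_def\<close>)
qed

text \<open>Multiplication of truncated expansions with explicit error constants. The left side of
  the condition on \<open>C\<close> collects everything of order \<open>q ^ 3\<close>, with surplus
  powers of \<open>norm q\<close> replaced by powers of 1/1000; for numerical coefficients it is
  checked by evaluation.\<close>

lemma quadratic_approx_mult:
  fixes q f g :: complex and a b c d :: real
  assumes q: "norm q \<le> 1/1000"
    and f: "norm (f - (1 + a * q + b * q\<^sup>2)) \<le> A * norm q ^ 3"
    and g: "norm (g - (1 + c * q + d * q\<^sup>2)) \<le> B * norm q ^ 3"
    and "A \<ge> 0" "B \<ge> 0"
    and C: "\<bar>a * d + b * c\<bar> + \<bar>b * d\<bar> / 1000 + A * (1 + \<bar>c\<bar> / 1000 + \<bar>d\<bar> / 1000\<^sup>2 + B / 1000 ^ 3)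
        + B * (1 + \<bar>a\<bar> / 1000 + \<bar>b\<bar> / 1000\<^sup>2) \<le> C"
  shows "norm (f * g - (1 + (a + c) * q + (b + d + a * c) * q\<^sup>2)) \<le> C * norm q ^ 3"
proof -
  define r where "r = norm q"
  have r: "0 \<le> r" "r \<le> 1/1000" using assms by (auto simp: r_def)
  have rp: "r ^ 2 \<le> (1/1000) ^ 2" "r ^ 3 \<le> (1/1000) ^ 3"
    using r by (intro power_mono; simp)+
  define f0 where "f0 = 1 + a * q + b * q\<^sup>2"
  define g0 where "g0 = 1 + c * q + d * q\<^sup>2"
  have nf: "norm f0 \<le> 1 + \<bar>a\<bar> / 1000 + \<bar>b\<bar> / 1000\<^sup>2"
  proof -
    have "norm f0 \<le> 1 + \<bar>a\<bar> * r + \<bar>b\<bar> * r\<^sup>2"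
      unfolding f0_def
      by (rule order_trans[OF norm_triangle_ineq] add_mono
          | simp add: norm_power norm_mult r_def)+
    also have "\<dots> \<le> 1 + \<bar>a\<bar> * (1/1000) + \<bar>b\<bar> * (1/1000)\<^sup>2"
      using r rp by (intro add_mono mult_left_mono) auto
    finally show ?thesis by (simp add: power_divide)
  qed
  have ng0: "norm g0 \<le> 1 + \<bar>c\<bar> / 1000 + \<bar>d\<bar> / 1000\<^sup>2"
  proof -
    have "norm g0 \<le> 1 + \<bar>c\<bar> * r + \<bar>d\<bar> * r\<^sup>2"
      unfolding g0_def
      by (rule order_trans[OF norm_triangle_ineq] add_mono
          | simp add: norm_power norm_mult r_def)+
    also have "\<dots> \<le> 1 + \<bar>c\<bar> * (1/1000) + \<bar>d\<bar> * (1/1000)\<^sup>2"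
      using r rp by (intro add_mono mult_left_mono) auto
    finally show ?thesis by (simp add: power_divide)
  qed
  have ng: "norm g \<le> 1 + \<bar>c\<bar> / 1000 + \<bar>d\<bar> / 1000\<^sup>2 + B / 1000 ^ 3"
  proof -
    have "norm g \<le> norm g0 + norm (g - g0)"
      using norm_triangle_ineq[of g0 "g - g0"] by simp
    also have "norm (g - g0) \<le> B * (1/1000) ^ 3"
      using order_trans[OF g[folded g0_def] mult_left_mono[OF rp(2)[unfolded r_def] \<open>B \<ge> 0\<close>]] .
    finally show ?thesis using ng0 by (simp add: power_divide)
  qed
  have nl: "norm ((a * d + b * c) + (b * d) * q) \<le> \<bar>a * d + b * c\<bar> + \<bar>b * d\<bar> / 1000"
  proof -
    have "norm (complex_of_real (a * d + b * c) + of_real (b * d) * q) \<le> \<bar>a * d + b * c\<bar> + \<bar>b * d\<bar> * r"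
      by (rule order_trans[OF norm_triangle_ineq]) (simp only: norm_mult norm_of_real r_def)
    also have "\<dots> \<le> \<bar>a * d + b * c\<bar> + \<bar>b * d\<bar> * (1/1000)"
      using r by (intro add_mono mult_left_mono) auto
    finally show ?thesis by simp
  qed
  \<comment> \<open>The first summand is the part of \<open>f0 * g0\<close> of degree 3 and 4; the
    other two are the telescoping of \<open>f * g - f0 * g0\<close>.\<close>
  have "f * g - (1 + (a + c) * q + (b + d + a * c) * q\<^sup>2)
      = ((a * d + b * c) + (b * d) * q) * q ^ 3 + (f - f0) * g + f0 * (g - g0)"
    by (simp add: f0_def g0_def algebra_simps power2_eq_square power3_eq_cube)
  also have "norm \<dots> \<le> norm ((a * d + b * c) + (b * d) * q) * r ^ 3
      + norm (f - f0) * norm g + norm f0 * norm (g - g0)"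
    by (rule order_trans[OF norm_triangle_ineq] add_mono | simp add: norm_mult norm_power r_def)+
  also have "\<dots> \<le> (\<bar>a * d + b * c\<bar> + \<bar>b * d\<bar> / 1000) * r ^ 3
      + (A * r ^ 3) * (1 + \<bar>c\<bar> / 1000 + \<bar>d\<bar> / 1000\<^sup>2 + B / 1000 ^ 3)
      + (1 + \<bar>a\<bar> / 1000 + \<bar>b\<bar> / 1000\<^sup>2) * (B * r ^ 3)"
    using f g nf ng nl r assms(4,5) unfolding f0_def g0_def r_def
    by (intro add_mono mult_mono) auto
  also have "\<dots> = (\<bar>a * d + b * c\<bar> + \<bar>b * d\<bar> / 1000
      + A * (1 + \<bar>c\<bar> / 1000 + \<bar>d\<bar> / 1000\<^sup>2 + B / 1000 ^ 3)
      + B * (1 + \<bar>a\<bar> / 1000 + \<bar>b\<bar> / 1000\<^sup>2)) * r ^ 3"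
    by (simp add: algebra_simps)
  also have "\<dots> \<le> C * r ^ 3"
    using C r by (intro mult_right_mono) auto
  finally show ?thesis by (simp add: r_def)
qed

text \<open>The powers are built along the chain 1, 2, 3, 6, 12, 24. Each error constant is an upper
  bound for the expression required by the multiplication lemma.\<close>

lemma euler_prod_power_24_approx:
  fixes q :: complex
  assumes q: "norm q \<le> 1/1000"
  shows "norm (euler_prod q ^ 24 - (1 - 24 * q + 252 * q\<^sup>2)) \<le> 1700 * norm q ^ 3"
proof -
  define e where "e = euler_prod q"
  note mult = quadratic_approx_mult[OF q]
  have 1: "norm (e - (1 + of_real (-1) * q + of_real (-1) * q\<^sup>2)) \<le> 4 * norm q ^ 3"
    using euler_prod_approx[OF q] by (simp add: e_def)
  have 2: "norm (e ^ 2 - (1 + of_real (-2) * q + of_real (-1) * q\<^sup>2)) \<le> 11 * norm q ^ 3"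
    using mult[OF 1 1, of 11] by (simp add: power2_eq_square)
  have 3: "norm (e ^ 3 - (1 + of_real (-3) * q + of_real 0 * q\<^sup>2)) \<le> 19 * norm q ^ 3"
    using mult[OF 2 1, of 19] by (simp add: power2_eq_square power3_eq_cube mult.assoc)
  have 6: "norm (e ^ 6 - (1 + of_real (-6) * q + of_real 9 * q\<^sup>2)) \<le> 39 * norm q ^ 3"
    using mult[OF 3 3, of 39] by (simp flip: power_add)
  have 12: "norm (e ^ 12 - (1 + of_real (-12) * q + of_real 54 * q\<^sup>2)) \<le> 188 * norm q ^ 3"
    using mult[OF 6 6, of 188] by (simp flip: power_add)
  show ?thesis
    using mult[OF 12 12, of 1700] by (simp add: e_def flip: power_add)
qed

section \<open>The second Taylor coefficient on the imaginary axis\<close>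

text \<open>With \<theta> = \<open>q\<close> d/d\<open>q\<close> and \<open>K = Delta_q\<close> this
  is \<open>39 K - 13 x\<close> \<theta>\<open>K + x\<^sup>2\<close>
  \<theta>\<theta>\<open>K\<close>. On the monomial \<open>q ^ n\<close> this operator is
  multiplication by \<open>(n x)\<^sup>2 - 13 (n x) + 39\<close>.\<close>

definition Delta_coeff2 :: "real \<Rightarrow> complex" where
  "Delta_coeff2 x = (let q = exp (- of_real x) in
     39 * Delta_q q - 13 * x * q * deriv Delta_q q
       + x\<^sup>2 * (q * deriv Delta_q q + q\<^sup>2 * deriv (deriv Delta_q) q))"

text \<open>The Cayley transform \<open>(1 + z) / (1 - z)\<close> maps the unit disc to the right
  half-plane. The form \<open>2 * inverse (1 - z) - 1\<close> leaves only
  \<open>inverse (1 - z)\<close> to differentiate later.\<close>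

lemma Re_Cayley_pos:
  assumes "norm z < 1"
  shows "Re (2 * inverse (1 - z) - 1) > 0"
proof -
  have "1 - z \<noteq> 0" using assms by auto
  then have "2 * inverse (1 - z) - 1 = (1 + z) / (1 - z)"
    by (simp add: field_simps)
  moreover have "Re ((1 + z) * cnj (1 - z)) = 1 - ((Re z)\<^sup>2 + (Im z)\<^sup>2)"
    by (simp add: algebra_simps power2_eq_square)
  then have "Re ((1 + z) * cnj (1 - z)) > 0"
    using assms by (simp add: cmod_def)
  ultimately show ?thesis
    by (simp only: complex_div_gt_0)
qed

text \<open>At \<open>\<i> * \<beta>\<close> the matrix acts as \<i>\<beta> times the Cayley
  transform. Its determinant \<open>1 / (2 * \<i> * \<beta>)\<close> to the power 6 against the 12th
  power of \<open>(1 - z) / (2 * \<i> * \<beta>)\<close> leaves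
  \<open>(2 * \<i> * \<beta>) ^ 6\<close>.\<close>

lemma slash12_sigma_mat_imaginary:
  fixes \<beta> :: real
  assumes "\<beta> > 0" "norm z < 1"
  defines "x \<equiv> 2 * pi * \<beta>"
  shows "slash12 modular_Delta (sigma_mat (\<i> * of_real \<beta>)) z
      = (2 * \<i> * \<beta>) ^ 6 * (Delta_q (exp (- (x * (2 * inverse (1 - z) - 1)))) * inverse (1 - z) ^ 12)"
proof -
  have z1: "1 - z \<noteq> 0" using assms(2) by auto
  let ?A = "sigma_mat (\<i> * of_real \<beta>)"
  have entries: "?A$1$1 = 1/2" "?A$1$2 = 1/2" "?A$2$1 = - 1 / (2 * \<i> * \<beta>)" "?A$2$2 = 1 / (2 * \<i> * \<beta>)"
    using assms(1) by (simp_all add: sigma_mat_def map_matrix_def field_simps)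
  have det: "det ?A = 1 / (2 * \<i> * \<beta>)"
    using assms(1) by (simp add: det_2 entries field_simps)
  have den: "?A$2$1 * z + ?A$2$2 = (1 - z) / (2 * \<i> * \<beta>)"
    by (simp add: entries diff_divide_distrib)
  have fl: "frac_lin ?A z = \<i> * \<beta> * (2 * inverse (1 - z) - 1)"
    unfolding frac_lin_def den using z1 assms(1) by (simp add: entries field_simps)
  have "Im (frac_lin ?A z) > 0"
    using Re_Cayley_pos[OF assms(2)] assms(1) by (simp add: fl)
  then have "modular_Delta (frac_lin ?A z) = Delta_q (exp (2 * of_real pi * \<i> * frac_lin ?A z))"
    by (rule modular_Delta_eq_Delta_q)
  also have "2 * of_real pi * \<i> * frac_lin ?A z = - (x * (2 * inverse (1 - z) - 1))"
    by (simp add: fl x_def algebra_simps)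
  finally have D: "modular_Delta (frac_lin ?A z) = Delta_q (exp (- (x * (2 * inverse (1 - z) - 1))))" .
  show ?thesis
    unfolding slash12_def det den D using z1 assms(1)
    by (simp add: power_divide power_inverse field_simps flip: power_add)
qed

lemma interior_coeff_2_imaginary:
  fixes \<beta> :: real
  assumes "\<beta> > 0"
  shows "interior_coeff modular_Delta (\<i> * of_real \<beta>) 2
      = 2 * (2 * \<i> * \<beta>) ^ 6 * Delta_coeff2 (2 * pi * \<beta>)"
proof -
  define x where "x = complex_of_real (2 * pi * \<beta>)"
  define c where "c = (2 * \<i> * complex_of_real \<beta>) ^ 6"
  define w where "w z = inverse (1 - z)" for z :: complex
  define u where "u z = exp (- (x * (2 * w z - 1)))" for z
  define h where "h z = c * (Delta_q (u z) * w z ^ 12)" for z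
  \<comment> \<open>\<open>h1\<close> is the derivative of \<open>h\<close>; in terms of \<open>w\<close> one has \<open>w' = w\<^sup>2\<close> and \<open>u' = - 2 x w\<^sup>2 u\<close>.\<close>
  define h1 where "h1 z = c * (12 * w z ^ 13 * Delta_q (u z)
      - 2 * x * w z ^ 14 * (u z * deriv Delta_q (u z)))" for z
  let ?f = "slash12 modular_Delta (sigma_mat (\<i> * of_real \<beta>))"
  have f_eq: "?f z = h z" if "z \<in> ball 0 1" for z
    using slash12_sigma_mat_imaginary[OF assms, of z] that
    by (simp add: h_def c_def u_def x_def w_def)
  have u_ball: "u z \<in> ball 0 1" if "z \<in> ball 0 1" for z
    using Re_Cayley_pos[of z] that assms by (simp add: u_def x_def w_def norm_exp_eq_Re)
  have dw: "(w has_field_derivative w z ^ 2) (at z)" if "z \<in> ball 0 1" for z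
  proof -
    have "1 - z \<noteq> 0" using that by auto
    then show ?thesis unfolding w_def
      by (auto intro!: derivative_eq_intros simp: power2_eq_square)
  qed
  have du: "(u has_field_derivative - (2 * x * w z ^ 2 * u z)) (at z)" if "z \<in> ball 0 1" for z
    unfolding u_def by (rule derivative_eq_intros dw[OF that] refl | simp)+
  have dK: "((\<lambda>z. Delta_q (u z)) has_field_derivative
      deriv Delta_q (u z) * - (2 * x * w z ^ 2 * u z)) (at z)" if "z \<in> ball 0 1" for z
    by (rule DERIV_chain2[OF holomorphic_derivI[OF holomorphic_Delta_q open_ball u_ball[OF that]] du[OF that]])
  have dK1: "((\<lambda>z. deriv Delta_q (u z)) has_field_derivative
      deriv (deriv Delta_q) (u z) * - (2 * x * w z ^ 2 * u z)) (at z)" if "z \<in> ball 0 1" for z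
    by (rule DERIV_chain2[OF holomorphic_derivI[OF holomorphic_deriv[OF holomorphic_Delta_q open_ball]
          open_ball u_ball[OF that]] du[OF that]])
  have dh: "(h has_field_derivative h1 z) (at z)" if "z \<in> ball 0 1" for z
    unfolding h_def
    by (rule derivative_eq_intros dw[OF that] dK[OF that] refl)+
      (simp add: h1_def algebra_simps flip: power_add)
  \<comment> \<open>At 0, where \<open>w = 1\<close>, the coefficients are 12 * 13 = 156 for
    \<open>K\<close>, -(24 + 28) = -52 for \<open>x\<close> \<theta>\<open>K\<close> and 4 for
    \<open>x\<^sup>2\<close> \<theta>\<theta>\<open>K\<close>; the common factor is 4. Division by
    2! then gives the factor 2 of the statement.\<close>
  have dh1: "(h1 has_field_derivative 4 * c * Delta_coeff2 (2 * pi * \<beta>)) (at 0)"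
  proof -
    have 0: "(0::complex) \<in> ball 0 1" by simp
    have w0: "w 0 = 1" by (simp add: w_def)
    have u0: "u 0 = exp (- x)" by (simp add: u_def w0)
    show ?thesis
      unfolding h1_def
      by (rule derivative_eq_intros dw[OF 0] du[OF 0] dK[OF 0] dK1[OF 0] refl)+
        (simp add: w0 u0 Delta_coeff2_def Let_def x_def algebra_simps power2_eq_square)
  qed
  have ev: "\<forall>\<^sub>F z in nhds 0. z \<in> ball (0::complex) 1"
    by (intro eventually_nhds_in_open) auto
  have d1: "deriv ?f z = h1 z" if z: "z \<in> ball 0 1" for z
  proof -
    have "\<forall>\<^sub>F y in nhds z. y \<in> ball (0::complex) 1"
      using z by (intro eventually_nhds_in_open) auto
    then have "deriv ?f z = deriv h z"
      by (intro deriv_cong_ev) (auto elim!: eventually_mono simp: f_eq)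
    then show ?thesis using dh[OF z] by (simp add: DERIV_imp_deriv)
  qed
  have "deriv (deriv ?f) 0 = deriv h1 0"
    using ev by (intro deriv_cong_ev) (auto elim!: eventually_mono simp: d1)
  also have "\<dots> = 4 * c * Delta_coeff2 (2 * pi * \<beta>)"
    using dh1 by (rule DERIV_imp_deriv)
  finally show ?thesis
    by (simp add: interior_coeff_def fps_expansion_def c_def numeral_2_eq_2)
qed

text \<open>Reduces the search for a zero to the real part, where the intermediate value theorem
  applies.\<close>

lemma Delta_coeff2_in_Reals:
  assumes "x > 0"
  shows "Delta_coeff2 x \<in> \<real>"
proof -
  have "exp (- complex_of_real x) \<in> \<real>" "norm (exp (- complex_of_real x)) < 1"
    using assms by (auto simp flip: of_real_minus exp_of_real)
  then show ?thesis
    using Delta_q_in_Reals Delta_q_derivs_in_Reals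
    by (auto simp: Delta_coeff2_def Let_def intro!: Reals_add Reals_diff Reals_mult Reals_power)
qed

lemma continuous_on_Delta_coeff2: "continuous_on {0<..} Delta_coeff2"
proof -
  have im: "(\<lambda>x. exp (- complex_of_real x)) ` {0<..} \<subseteq> ball 0 1"
    by (auto simp: norm_exp_eq_Re)
  have e: "continuous_on {0<..} (\<lambda>x. exp (- complex_of_real x))"
    by (intro continuous_intros)
  have 0: "continuous_on (ball 0 1) Delta_q"
    by (intro holomorphic_on_imp_continuous_on holomorphic_Delta_q)
  have 1: "continuous_on (ball 0 1) (deriv Delta_q)"
    by (intro holomorphic_on_imp_continuous_on holomorphic_deriv holomorphic_Delta_q open_ball)
  have 2: "continuous_on (ball 0 1) (deriv (deriv Delta_q))"
    by (intro holomorphic_on_imp_continuous_on holomorphic_deriv holomorphic_Delta_q open_ball)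
  show ?thesis
    unfolding Delta_coeff2_def Let_def
    by (intro continuous_intros e continuous_on_compose2[OF 0 e im]
        continuous_on_compose2[OF 1 e im] continuous_on_compose2[OF 2 e im])
qed

section \<open>Numerical estimates\<close>

text \<open>On the closed disc of radius \<open>r = norm q\<close> about \<open>q\<close> all points
  have norm at most \<open>2 * r \<le> 1/1000\<close>, so the remainder there is at most
  \<open>1700 * (2 * r) ^ 4 = 27200 * r ^ 4\<close>. Cauchy's inequality divides this by
  \<open>r ^ n\<close> and multiplies by \<open>fact n\<close>.\<close>

lemma Delta_q_derivs_approx:
  fixes q :: complex
  assumes q: "0 < norm q" "norm q \<le> 1/2000"
  shows "norm (Delta_q q - (q - 24 * q\<^sup>2 + 252 * q ^ 3)) \<le> 1700 * norm q ^ 4"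
    and "norm (deriv Delta_q q - (1 - 48 * q + 756 * q\<^sup>2)) \<le> 27200 * norm q ^ 3"
    and "norm (deriv (deriv Delta_q) q - (- 48 + 1512 * q)) \<le> 54400 * norm q ^ 2"
proof -
  define r where "r = norm q"
  have r: "0 < r" "r \<le> 1/2000" using q by (auto simp: r_def)
  define R where "R z = Delta_q z - (z - 24 * z\<^sup>2 + 252 * z ^ 3)" for z
  have R_bound: "norm (R z) \<le> 1700 * norm z ^ 4" if "norm z \<le> 1/1000" for z
  proof -
    have "R z = z * (euler_prod z ^ 24 - (1 - 24 * z + 252 * z\<^sup>2))"
      by (simp add: R_def Delta_q_def algebra_simps power2_eq_square power3_eq_cube)
    then have "norm (R z) = norm z * norm (euler_prod z ^ 24 - (1 - 24 * z + 252 * z\<^sup>2))"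
      by (simp add: norm_mult)
    also have "\<dots> \<le> norm z * (1700 * norm z ^ 3)"
      by (intro mult_left_mono euler_prod_power_24_approx that) auto
    finally show ?thesis by (simp add: power4_eq_xxxx power3_eq_cube mult_ac)
  qed
  then show "norm (Delta_q q - (q - 24 * q\<^sup>2 + 252 * q ^ 3)) \<le> 1700 * norm q ^ 4"
    using q by (simp add: R_def)
  have R_hol: "R holomorphic_on ball 0 1"
    unfolding R_def by (intro holomorphic_intros holomorphic_Delta_q)
  have near: "norm z \<le> 2 * r" if "norm (q - z) \<le> r" for z
    using that norm_triangle_ineq[of q "z - q"] by (simp add: r_def norm_minus_commute)
  have sub: "cball q r \<subseteq> ball 0 1"
  proof
    fix z assume "z \<in> cball q r"
    then have "norm z \<le> 2 * r" using near by (simp add: dist_norm)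
    then show "z \<in> ball 0 1" using r by simp
  qed
  have cauchy: "norm ((deriv ^^ n) R q) \<le> fact n * (1700 * (2 * r) ^ 4) / r ^ n" for n
  proof (rule Cauchy_inequality)
    show "R holomorphic_on ball q r"
      by (rule holomorphic_on_subset[OF R_hol subset_trans[OF ball_subset_cball sub]])
    show "continuous_on (cball q r) R"
      by (rule continuous_on_subset[OF holomorphic_on_imp_continuous_on[OF R_hol] sub])
    show "0 < r" by fact
    fix z assume z: "norm (q - z) = r"
    have "norm (R z) \<le> 1700 * norm z ^ 4"
      using near[of z] z r by (intro R_bound) auto
    also have "\<dots> \<le> 1700 * (2 * r) ^ 4"
      using near[of z] z by (intro mult_left_mono power_mono) auto
    finally show "norm (R z) \<le> 1700 * (2 * r) ^ 4" .
  qed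
  have dR: "deriv R z = deriv Delta_q z - (1 - 48 * z + 756 * z\<^sup>2)" if "z \<in> ball 0 1" for z
    unfolding R_def
    by (rule DERIV_imp_deriv)
      (rule derivative_eq_intros holomorphic_derivI[OF holomorphic_Delta_q open_ball that] refl | simp)+
  have q1: "q \<in> ball 0 1" using q by auto
  have ddR: "deriv (deriv R) q = deriv (deriv Delta_q) q - (- 48 + 1512 * q)"
  proof -
    have "\<forall>\<^sub>F y in nhds q. y \<in> ball (0::complex) 1"
      using q1 by (intro eventually_nhds_in_open) auto
    then have "deriv (deriv R) q = deriv (\<lambda>z. deriv Delta_q z - (1 - 48 * z + 756 * z\<^sup>2)) q"
      by (intro deriv_cong_ev) (auto elim!: eventually_mono simp: dR)
    also have "\<dots> = deriv (deriv Delta_q) q - (- 48 + 1512 * q)"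
      by (rule DERIV_imp_deriv)
        (rule derivative_eq_intros holomorphic_derivI[OF holomorphic_deriv[OF holomorphic_Delta_q open_ball]
            open_ball q1] refl | simp)+
    finally show ?thesis .
  qed
  show "norm (deriv Delta_q q - (1 - 48 * q + 756 * q\<^sup>2)) \<le> 27200 * norm q ^ 3"
    using cauchy[of 1] r by (simp add: dR[OF q1] power4_eq_xxxx power3_eq_cube flip: r_def)
  show "norm (deriv (deriv Delta_q) q - (- 48 + 1512 * q)) \<le> 54400 * norm q ^ 2"
  proof -
    have "(deriv ^^ 2) R q = deriv (deriv R) q" by (simp add: numeral_2_eq_2)
    then show ?thesis
      using cauchy[of 2] r by (simp add: ddR power4_eq_xxxx power2_eq_square flip: r_def)
  qed
qed

text \<open>The operator multiplies \<open>q ^ n\<close> by \<open>p (n * x)\<close>, which turns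
  the three leading terms of \<open>Delta_q\<close> into the main term. A factor \<open>q\<close> is
  pulled out on both sides, since only the sign of the bracket matters.\<close>

lemma Delta_coeff2_approx:
  fixes x :: real
  assumes x: "0 \<le> x" "x \<le> 9" and q_le: "exp (- x) \<le> 1/2000"
  defines "q \<equiv> exp (- x)" and "p \<equiv> \<lambda>y::real. y\<^sup>2 - 13 * y + 39"
  shows "\<bar>Re (Delta_coeff2 x) - q * (p x - 24 * q * p (2 * x) + 252 * q\<^sup>2 * p (3 * x))\<bar> \<le> q * (10 ^ 7 * q ^ 3)"
proof -
  define Q where "Q = complex_of_real q"
  have Q: "exp (- complex_of_real x) = Q"
    by (simp add: Q_def q_def flip: exp_of_real)
  have q0: "0 < q" by (simp add: q_def)
  have nQ: "norm Q = q" using q0 by (simp add: Q_def)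
  define E0 where "E0 = Delta_q Q - (Q - 24 * Q\<^sup>2 + 252 * Q ^ 3)"
  define E1 where "E1 = deriv Delta_q Q - (1 - 48 * Q + 756 * Q\<^sup>2)"
  define E2 where "E2 = deriv (deriv Delta_q) Q - (- 48 + 1512 * Q)"
  have E: "norm E0 \<le> 1700 * q ^ 4" "norm E1 \<le> 27200 * q ^ 3" "norm E2 \<le> 54400 * q ^ 2"
    using Delta_q_derivs_approx[of Q] q0 q_le by (simp_all add: E0_def E1_def E2_def nQ q_def)
  have D: "Delta_q Q = E0 + (Q - 24 * Q\<^sup>2 + 252 * Q ^ 3)" "deriv Delta_q Q = E1 + (1 - 48 * Q + 756 * Q\<^sup>2)"
    "deriv (deriv Delta_q) Q = E2 + (- 48 + 1512 * Q)"
    by (simp_all add: E0_def E1_def E2_def)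
  define T where "T = 39 * E0 + of_real (x\<^sup>2 - 13 * x) * Q * E1 + of_real (x\<^sup>2) * Q\<^sup>2 * E2"
  have "Delta_coeff2 x = of_real (q * (p x - 24 * q * p (2 * x) + 252 * q\<^sup>2 * p (3 * x))) + T"
    unfolding Delta_coeff2_def Let_def Q D T_def p_def
    by (simp add: Q_def algebra_simps power2_eq_square power3_eq_cube)
  then have "\<bar>Re (Delta_coeff2 x) - q * (p x - 24 * q * p (2 * x) + 252 * q\<^sup>2 * p (3 * x))\<bar> = \<bar>Re T\<bar>"
    by simp
  also have "\<dots> \<le> norm T" by (rule abs_Re_le_cmod)
  also have "\<dots> \<le> 39 * norm E0 + \<bar>x\<^sup>2 - 13 * x\<bar> * q * norm E1 + x\<^sup>2 * q\<^sup>2 * norm E2"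
  proof -
    have "norm T \<le> norm (39 * E0) + norm (of_real (x\<^sup>2 - 13 * x) * Q * E1) + norm (of_real (x\<^sup>2) * Q\<^sup>2 * E2)"
      unfolding T_def by (intro order_trans[OF norm_triangle_ineq] add_mono order_refl)
    then show ?thesis
      by (simp only: norm_mult norm_of_real norm_power nQ) simp
  qed
  \<comment> \<open>From \<open>x \<le> 9\<close>: 198 = 81 + 13 * 9. The three constants add up to
    9858300, just below \<open>10 ^ 7\<close>.\<close>
  also have "\<dots> \<le> 39 * (1700 * q ^ 4) + 198 * q * (27200 * q ^ 3) + 81 * q\<^sup>2 * (54400 * q\<^sup>2)"
  proof -
    have x2: "0 \<le> x\<^sup>2" "x\<^sup>2 \<le> 81" using power_mono[OF x(2,1), of 2] by auto
    then have "\<bar>x\<^sup>2 - 13 * x\<bar> \<le> 198" using x unfolding abs_le_iff by linarith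
    with x2 E q0 show ?thesis
      by (intro add_mono mult_mono) auto
  qed
  also have "\<dots> \<le> q * (10 ^ 7 * q ^ 3)"
    using q0 by (simp add: power4_eq_xxxx power3_eq_cube power2_eq_square)
  finally show ?thesis .
qed

section \<open>Bounds for the exponential and the sign change\<close>

lemma exp_ge_quadratic_power_8:
  fixes t :: real
  assumes "t \<ge> 0"
  shows "(1 + t / 8 + (t / 8)\<^sup>2 / 2) ^ 8 \<le> exp t"
proof -
  have "(1 + t / 8 + (t / 8)\<^sup>2 / 2) ^ 8 \<le> exp (t / 8) ^ 8"
    using assms by (intro power_mono exp_lower_Taylor_quadratic) auto
  also have "\<dots> = exp t" by (simp flip: exp_of_nat_mult)
  finally show ?thesis .
qed

text \<open>Both bounds come from lower bounds for \<open>exp\<close> at small arguments and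
  decimals of e: above via \<open>exp x \<ge> exp 8 * exp 0.442\<close>, below via
  \<open>exp (- x) = exp (9 - x) / exp 9\<close> with 9 - 8.447 = 0.553.\<close>

lemma exp_minus_bounds:
  fixes x :: real
  assumes "8.442 \<le> x" "x \<le> 8.447"
  shows "exp (- x) \<le> 0.000216" "0.000214 \<le> exp (- x)"
proof -
  have e: "2.71828 \<le> exp (1::real)" "exp (1::real) \<le> 2.71829"
    using e_approx_32 unfolding abs_le_iff by simp_all
  have "4630 \<le> (2.71828::real) ^ 8 * (1 + 0.442 / 8 + (0.442 / 8)\<^sup>2 / 2) ^ 8"
    by (simp add: power_divide eval_nat_numeral)
  also have "\<dots> \<le> exp 1 ^ 8 * exp 0.442"
    using e by (intro mult_mono power_mono exp_ge_quadratic_power_8) auto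
  also have "\<dots> = exp (8.442::real)"
    by (simp flip: exp_of_nat_mult exp_add)
  also have "\<dots> \<le> exp x" using assms by simp
  finally show "exp (- x) \<le> 0.000216" by (simp add: exp_minus field_simps)
  have "0.000214 * (2.71829::real) ^ 9 \<le> (1 + 0.553 / 8 + (0.553 / 8)\<^sup>2 / 2) ^ 8"
    by (simp add: power_divide eval_nat_numeral)
  also have "\<dots> \<le> exp (0.553::real)"
    by (intro exp_ge_quadratic_power_8) auto
  also have "\<dots> \<le> exp (9 - x)" using assms by simp
  also have "\<dots> = exp (- x) * exp 1 ^ 9"
    by (simp flip: exp_of_nat_mult exp_add)
  also have "\<dots> \<le> exp (- x) * 2.71829 ^ 9"
    using e by (intro mult_left_mono power_mono) auto
  finally show "0.000214 \<le> exp (- x)" by simp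
qed

lemma Delta_coeff2_sign_change:
  "Re (Delta_coeff2 8.442) \<le> 0" "0 \<le> Re (Delta_coeff2 8.447)"
proof -
  define s :: "real \<Rightarrow> real" where "s x = (x\<^sup>2 - 13 * x + 39) - 24 * exp (- x) * ((2 * x)\<^sup>2 - 13 * (2 * x) + 39)
    + 252 * (exp (- x))\<^sup>2 * ((3 * x)\<^sup>2 - 13 * (3 * x) + 39)" for x
  have near: "\<bar>Re (Delta_coeff2 x) - exp (- x) * s x\<bar> \<le> exp (- x) * 0.00011"
    if "8.442 \<le> x" "x \<le> 8.447" for x
  proof -
    have q: "exp (- x) \<le> 0.000216" using that by (rule exp_minus_bounds)
    then have "exp (- x) ^ 3 \<le> 0.000216 ^ 3" by (intro power_mono) auto
    then have q3: "10 ^ 7 * exp (- x) ^ 3 \<le> 0.00011" by (simp add: power_divide)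
    have "\<bar>Re (Delta_coeff2 x) - exp (- x) * s x\<bar> \<le> exp (- x) * (10 ^ 7 * exp (- x) ^ 3)"
      unfolding s_def by (rule Delta_coeff2_approx) (use that q in auto)
    also have "\<dots> \<le> exp (- x) * 0.00011"
      by (intro mult_left_mono q3) auto
    finally show ?thesis .
  qed
  have q2: "0.000214\<^sup>2 \<le> (exp (- x))\<^sup>2" "(exp (- x))\<^sup>2 \<le> 0.000216\<^sup>2"
    if "8.442 \<le> x" "x \<le> 8.447" for x :: real
    using exp_minus_bounds[OF that] by (intro power_mono; simp)+
  \<comment> \<open>The endpoints are chosen so that the interval divided by 2\<pi> fits into
    (1.3435, 1.3445).\<close>
  define x1 x2 :: real where "x1 = 8.442" and "x2 = 8.447"
  have x1: "8.442 \<le> x1" "x1 \<le> 8.447" and x2: "8.442 \<le> x2" "x2 \<le> 8.447"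
    by (simp_all add: x1_def x2_def)
  have p1: "x1\<^sup>2 - 13 * x1 + 39 \<le> 0.5217" "(2 * x1)\<^sup>2 - 13 * (2 * x1) + 39 \<ge> 104.5"
    "(3 * x1)\<^sup>2 - 13 * (3 * x1) + 39 \<le> 352" "(3 * x1)\<^sup>2 - 13 * (3 * x1) + 39 \<ge> 0"
    by (simp_all add: x1_def power2_eq_square)
  have "exp (- x1) * ((2 * x1)\<^sup>2 - 13 * (2 * x1) + 39) \<ge> 0.000214 * 104.5"
    using exp_minus_bounds[OF x1] p1 by (intro mult_mono) auto
  moreover have "(exp (- x1))\<^sup>2 * ((3 * x1)\<^sup>2 - 13 * (3 * x1) + 39) \<le> 0.000216\<^sup>2 * 352"
    using q2[OF x1] p1 by (intro mult_mono) auto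
  ultimately have "s x1 \<le> - 0.00011"
    using p1 unfolding s_def mult.assoc by (simp add: power_divide)
  then have "exp (- x1) * s x1 \<le> exp (- x1) * (- 0.00011)" by (intro mult_left_mono) auto
  then have "Re (Delta_coeff2 x1) \<le> 0" using near[OF x1] by linarith
  then show "Re (Delta_coeff2 8.442) \<le> 0" by (simp only: x1_def)
  have p2: "x2\<^sup>2 - 13 * x2 + 39 \<ge> 0.5408" "(2 * x2)\<^sup>2 - 13 * (2 * x2) + 39 \<le> 104.79"
    "(3 * x2)\<^sup>2 - 13 * (3 * x2) + 39 \<ge> 351" "(2 * x2)\<^sup>2 - 13 * (2 * x2) + 39 \<ge> 0"
    by (simp_all add: x2_def power2_eq_square)
  have "exp (- x2) * ((2 * x2)\<^sup>2 - 13 * (2 * x2) + 39) \<le> 0.000216 * 104.79"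
    using exp_minus_bounds[OF x2] p2 by (intro mult_mono) auto
  \<comment> \<open>With these bounds the first two terms of \<open>s x2\<close> only give about
    -0.0024; the \<open>q\<^sup>2\<close> term adds about 0.0040 and decides the sign.\<close>
  moreover have "0.000214\<^sup>2 * 351 \<le> (exp (- x2))\<^sup>2 * ((3 * x2)\<^sup>2 - 13 * (3 * x2) + 39)"
    using q2[OF x2] p2 by (intro mult_mono) auto
  ultimately have "0.00011 \<le> s x2"
    using p2 unfolding s_def mult.assoc by (simp add: power_divide)
  then have "exp (- x2) * 0.00011 \<le> exp (- x2) * s x2" by (intro mult_left_mono) auto
  then have "0 \<le> Re (Delta_coeff2 x2)" using near[OF x2] by linarith
  then show "0 \<le> Re (Delta_coeff2 8.447)" by (simp only: x2_def)
qed

section \<open>Stabilizers on the imaginary axis\<close>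

text \<open>Real and imaginary parts of the fixed point equation give
  \<open>b = - c * \<beta>\<^sup>2\<close> and \<open>a = d\<close>, so the determinant condition
  becomes \<open>a\<^sup>2 + c\<^sup>2 * \<beta>\<^sup>2 = 1\<close>. As \<open>\<beta> > 1\<close>,
  this forces \<open>c = 0\<close>.\<close>

lemma PSL_stabilizer_imaginary:
  fixes \<beta> :: real
  assumes "\<beta> > 1"
  shows "PSL_stabilizer (\<i> * of_real \<beta>) = {{mat 1, - mat 1}}"
proof -
  have unit: "A = mat 1 \<or> A = - mat 1"
    if A: "A \<in> SL2Z" "frac_lin (complex_matrix A) (\<i> * of_real \<beta>) = \<i> * of_real \<beta>" for A :: "int^2^2"
  proof -
    define a b c d where "a = A$1$1" and "b = A$1$2" and "c = A$2$1" and "d = A$2$2"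
    note abcd = a_def b_def c_def d_def
    have det: "a * d - b * c = 1"
      using A(1) by (simp add: SL2Z_def det_2 abcd)
    have eq: "(of_int a * (\<i> * of_real \<beta>) + of_int b) / (of_int c * (\<i> * of_real \<beta>) + of_int d) = \<i> * of_real \<beta>"
      using A(2) by (simp add: frac_lin_def map_matrix_def abcd)
    \<comment> \<open>A zero denominator would make the quotient 0 by the convention for division,
      but \<i>\<beta> is not 0.\<close>
    then have "of_int c * (\<i> * of_real \<beta>) + complex_of_int d \<noteq> 0"
      using assms by auto
    then have "of_int a * (\<i> * of_real \<beta>) + of_int b = \<i> * of_real \<beta> * (of_int c * (\<i> * of_real \<beta>) + of_int d)"
      using eq by (simp add: divide_eq_eq)
    then have "Re (of_int a * (\<i> * of_real \<beta>) + of_int b) = Re (\<i> * of_real \<beta> * (of_int c * (\<i> * of_real \<beta>) + of_int d))"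
      "Im (of_int a * (\<i> * of_real \<beta>) + of_int b) = Im (\<i> * of_real \<beta> * (of_int c * (\<i> * of_real \<beta>) + of_int d))"
      by simp_all
    then have b: "real_of_int b = - (c * \<beta>\<^sup>2)" and ad: "a = d"
      using assms by (simp_all add: power2_eq_square)
    have sum1: "(real_of_int a)\<^sup>2 + (real_of_int c)\<^sup>2 * \<beta>\<^sup>2 = 1"
      using arg_cong[OF det, of real_of_int] by (simp add: b ad power2_eq_square algebra_simps)
    have "c = 0"
    proof (rule ccontr)
      assume "c \<noteq> 0"
      then have "1 \<le> c\<^sup>2" by (simp add: int_one_le_iff_zero_less)
      then have "1 \<le> (real_of_int c)\<^sup>2" by (metis of_int_1_le_iff of_int_power)
      moreover have "1 < \<beta>\<^sup>2" using assms by (simp add: power2_eq_square less_1_mult)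
      ultimately have "1 < (real_of_int c)\<^sup>2 * \<beta>\<^sup>2"
        using mult_right_mono[of 1 "(real_of_int c)\<^sup>2" "\<beta>\<^sup>2"] by simp
      then show False using sum1 zero_le_power2[of "real_of_int a"] by linarith
    qed
    then have "b = 0" using b by simp
    have "a * a = 1" using det ad \<open>b = 0\<close> by simp
    then have "a = 1 \<or> a = - 1" using zmult_eq_1_iff by auto
    then show ?thesis
      using \<open>b = 0\<close> \<open>c = 0\<close> ad by (auto simp: vec_eq_iff forall_2 mat_def abcd)
  qed
  have id: "mat 1 \<in> SL2Z" "frac_lin (complex_matrix (mat 1)) (\<i> * of_real \<beta>) = \<i> * of_real \<beta>"
    by (simp add: SL2Z_def) (simp add: frac_lin_def map_matrix_def mat_def)
  show ?thesis
  proof (intro equalityI subsetI)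
    fix X assume "X \<in> PSL_stabilizer (\<i> * of_real \<beta>)"
    then obtain A where "X = {A, - A}" "A = mat 1 \<or> A = - mat 1"
      unfolding PSL_stabilizer_def using unit by blast
    then show "X \<in> {{mat 1, - mat 1}}" by auto
  next
    fix X :: "(int^2^2) set" assume "X \<in> {{mat 1, - mat 1}}"
    then show "X \<in> PSL_stabilizer (\<i> * of_real \<beta>)"
      unfolding PSL_stabilizer_def using id by blast
  qed
qed

theorem theorem1p6:
  shows "A_Delta \<noteq> {} \<and>
    (\<exists>\<beta>::real. \<bar>\<beta> - 1.344\<bar> < 0.0005 \<and>
       Some (\<i> * of_real \<beta>) \<in> A_Delta \<and>
       interior_coeff modular_Delta (\<i> * of_real \<beta>) 2 = 0)"
proof -
  have "continuous_on {8.442..8.447} (\<lambda>x. Re (Delta_coeff2 x))"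
    by (intro continuous_intros continuous_on_subset[OF continuous_on_Delta_coeff2]) auto
  then obtain x where x: "8.442 \<le> x" "x \<le> 8.447" "Re (Delta_coeff2 x) = 0"
    using IVT'[of "\<lambda>x. Re (Delta_coeff2 x)" "8.442" 0 "8.447"] Delta_coeff2_sign_change by auto
  then have zero: "Delta_coeff2 x = 0"
    using Delta_coeff2_in_Reals[of x] by (auto simp: complex_eq_iff complex_is_Real_iff)
  define \<beta> where "\<beta> = x / (2 * pi)"
  have pi: "3.1415926 < pi" "pi < 3.1415927" using pi_approx by simp_all
  have x_eq: "x = 2 * pi * \<beta>" by (simp add: \<beta>_def)
  have "1.3435 < \<beta>" "\<beta> < 1.3445"
    using x pi by (simp_all add: \<beta>_def field_simps)
  then have close: "\<bar>\<beta> - 1.344\<bar> < 0.0005" and gt1: "\<beta> > 1" unfolding abs_less_iff by simp_all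
  have c0: "interior_coeff modular_Delta (\<i> * of_real \<beta>) 2 = 0"
    using interior_coeff_2_imaginary[of \<beta>] gt1 zero by (simp add: x_eq)
  \<comment> \<open>The stabilizer has one class, so the congruence is modulo 1.\<close>
  have "nontrivial_index (\<i> * of_real \<beta>) 2"
    using gt1 by (simp add: nontrivial_index_def PSL_stabilizer_imaginary)
  then have "Some (\<i> * of_real \<beta>) \<in> A_Delta"
    using c0 gt1 by (auto simp: A_Delta_def)
  with close c0 show ?thesis by blast
qed

end
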